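(* Let $r$ be a positive integer. If $r$ is even, every maximal anticode of diameter $r$ in the square grid (with Manhattan distance) is either a Lee sphere of radius $r/2$ or a quadricentred Lee sphere of radius $r/2$. If $r$ is odd, every maximal anticode of diameter $r$ in the square grid is a bicentred Lee sphere of radius $(r-1)/2$.
   Context: The square grid is $\mathbb{Z}^2$ with Manhattan distance $d((i_1,j_1),(i_2,j_2))=|i_2-i_1|+|j_2-j_1|$. An anticode of diameter $r$ is a set $S\subseteq\mathbb{Z}^2$ such that $d(x,y)\le r$ for all $x,y\in S$; it is maximal if $S\cup\{x\}$ has diameter greater than $r$ for every $x\notin S$. A Lee sphere of radius $R$ is the set of all points at Manhattan distance at most $R$ from a fixed centre point. A bicentred Lee sphere of radius $R$ is the set of all points at Manhattan distance at most $R$ from at least one of two centre points forming a $2\times1$ or $1\times2$ rectangle (i.e. two adjacent points). A quadricentred Lee sphere of radius $R$ is the set of all points at Manhattan distance at most $R-1$ from at least one of four centre points forming a $2\times2$ square. *)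

theory Defs
  imports Main
begin

type_synonym point = "int \<times> int"

definition manhattan :: "point \<Rightarrow> point \<Rightarrow> int" where
  "manhattan p q = \<bar>fst q - fst p\<bar> + \<bar>snd q - snd p\<bar>"

definition anticode :: "int \<Rightarrow> point set \<Rightarrow> bool" where
  "anticode r S \<longleftrightarrow> (\<forall>x\<in>S. \<forall>y\<in>S. manhattan x y \<le> r)"

text \<open>A set has diameter greater than \<open>r\<close> iff two of its points are at distance greater than \<open>r\<close>;
  this is meaningful for unbounded sets as well.\<close>

definition diameter_greater :: "int \<Rightarrow> point set \<Rightarrow> bool" where
  "diameter_greater r S \<longleftrightarrow> (\<exists>x\<in>S. \<exists>y\<in>S. manhattan x y > r)"

definition maximal_anticode :: "int \<Rightarrow> point set \<Rightarrow> bool" where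
  "maximal_anticode r S \<longleftrightarrow>
     anticode r S \<and> (\<forall>x. x \<notin> S \<longrightarrow> diameter_greater r (S \<union> {x}))"

definition points_within :: "int \<Rightarrow> point set \<Rightarrow> point set" where
  "points_within R C = {x. \<exists>c\<in>C. manhattan c x \<le> R}"

definition lee_sphere :: "int \<Rightarrow> point set \<Rightarrow> bool" where
  "lee_sphere R S \<longleftrightarrow> (\<exists>c. S = points_within R {c})"

definition bicentred_lee_sphere :: "int \<Rightarrow> point set \<Rightarrow> bool" where
  "bicentred_lee_sphere R S \<longleftrightarrow>
     (\<exists>i j. S = points_within R {(i, j), (i + 1, j)} \<or>
            S = points_within R {(i, j), (i, j + 1)})"

text \<open>The distance bound is \<open>R - 1\<close>, not \<open>R\<close>; radii are integers, so there is no truncation.\<close>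

definition quadricentred_lee_sphere :: "int \<Rightarrow> point set \<Rightarrow> bool" where
  "quadricentred_lee_sphere R S \<longleftrightarrow>
     (\<exists>i j. S = points_within (R - 1) {(i, j), (i + 1, j), (i, j + 1), (i + 1, j + 1)})"

end

theory Submission imports Defs
begin

text \<open>In the rotated coordinates \<open>u = x + y\<close>, \<open>v = x - y\<close> the Manhattan distance becomes the
  maximum distance, so an anticode of diameter \<open>r\<close> lies in a \<open>u\<close>-\<open>v\<close> box of side \<open>r\<close>, and such
  a box is itself an anticode. A maximal anticode is therefore exactly such a box. Since lattice
  points satisfy \<open>u \<equiv> v (mod 2)\<close>, the shape of the box depends only on the parity of \<open>r\<close> and on
  whether its lower corner satisfies this congruence.\<close>

definition diagonal_box :: "int \<Rightarrow> int \<Rightarrow> int \<Rightarrow> point set" where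
  "diagonal_box r a b =
     {(x, y). a \<le> x + y \<and> x + y \<le> a + r \<and> b \<le> x - y \<and> x - y \<le> b + r}"

text \<open>This is the identity \<open>\<bar>s\<bar> + \<bar>t\<bar> = max \<bar>s + t\<bar>
  \<bar>s - t\<bar>\<close>: a distance bound splits into independent bounds on \<open>u\<close> and
  \<open>v\<close>.\<close>

lemma manhattan_le_iff:
  "manhattan p q \<le> r \<longleftrightarrow>
     \<bar>(fst q + snd q) - (fst p + snd p)\<bar> \<le> r \<and> \<bar>(fst q - snd q) - (fst p - snd p)\<bar> \<le> r"
  unfolding manhattan_def by arith

lemma anticode_diagonal_box: "anticode r (diagonal_box r a b)"
  unfolding anticode_def manhattan_le_iff diagonal_box_def by auto

lemma bounded_spread_subset_interval:
  fixes f :: "'a \<Rightarrow> int"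
  assumes "S \<noteq> {}" and spread: "\<And>x y. x \<in> S \<Longrightarrow> y \<in> S \<Longrightarrow> \<bar>f y - f x\<bar> \<le> r"
  obtains a where "f ` S \<subseteq> {a..a + r}"
proof -
  obtain p where p: "p \<in> S" using assms(1) by blast
  \<comment> \<open>\<open>S\<close> itself may be infinite; comparing with one point
    \<open>p\<close> makes the image finite, so that its minimum is attained and can serve as
    \<open>a\<close>.\<close>
  have "f ` S \<subseteq> {f p - r..f p + r}" using spread[OF p] by fastforce
  then have fin: "finite (f ` S)" by (rule finite_subset) simp
  then have "Min (f ` S) \<in> f ` S" using p by (intro Min_in) auto
  then obtain q where q: "q \<in> S" "f q = Min (f ` S)" by auto
  then have "f q \<le> f x" if "x \<in> S" for x using fin that by simp
  then have "f ` S \<subseteq> {f q..f q + r}" using spread[OF q(1)] by fastforce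
  then show thesis by (rule that)
qed

lemma anticode_subset_diagonal_box:
  assumes "anticode r S" "S \<noteq> {}"
  obtains a b where "S \<subseteq> diagonal_box r a b"
proof -
  obtain a where a: "(\<lambda>p. fst p + snd p) ` S \<subseteq> {a..a + r}"
    using assms by (rule_tac bounded_spread_subset_interval[of S "\<lambda>p. fst p + snd p" r])
      (auto simp: anticode_def manhattan_le_iff)
  obtain b where b: "(\<lambda>p. fst p - snd p) ` S \<subseteq> {b..b + r}"
    using assms by (rule_tac bounded_spread_subset_interval[of S "\<lambda>p. fst p - snd p" r])
      (auto simp: anticode_def manhattan_le_iff)
  have "S \<subseteq> diagonal_box r a b" using a b by (fastforce simp: diagonal_box_def)
  then show thesis by (rule that)
qed

text \<open>Adding a point to the empty set gives a singleton, whose diameter 0 does not exceed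
  \<open>r\<close>.\<close>

lemma maximal_anticode_nonempty:
  assumes "maximal_anticode r S" "r \<ge> 0"
  shows "S \<noteq> {}"
  using assms by (auto simp: maximal_anticode_def diameter_greater_def manhattan_def)

text \<open>Turns maximality under adding one point into maximality under inclusion: a strictly
  larger anticode would contain \<open>S\<close> together with one further point.\<close>

lemma maximal_anticode_maximal:
  assumes "maximal_anticode r S" "anticode r T" "S \<subseteq> T"
  shows "S = T"
proof (rule ccontr)
  assume "S \<noteq> T"
  then obtain x where "x \<in> T" "x \<notin> S" using assms(3) by blast
  then have "diameter_greater r (S \<union> {x})" "S \<union> {x} \<subseteq> T"
    using assms unfolding maximal_anticode_def by blast+
  then show False using assms(2) unfolding anticode_def diameter_greater_def
    by (meson linorder_not_le subsetD)
qed

lemma maximal_anticode_diagonal_box: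
  assumes "maximal_anticode r S" "r \<ge> 0"
  obtains a b where "S = diagonal_box r a b"
proof -
  obtain a b where "S \<subseteq> diagonal_box r a b"
    using assms maximal_anticode_nonempty anticode_subset_diagonal_box
    unfolding maximal_anticode_def by metis
  then have "S = diagonal_box r a b"
    using maximal_anticode_maximal[OF assms(1) anticode_diagonal_box] by blast
  then show thesis by (rule that)
qed

lemma diagonal_box_eq_lee_sphere:
  "diagonal_box (2 * R) (i + j - R) (i - j - R) = points_within R {(i, j)}"
  unfolding diagonal_box_def points_within_def manhattan_le_iff by auto

text \<open>The middle \<open>(i + j + 1, i - j)\<close> of the box violates the parity condition,
  and the four centres are its neighbours along the \<open>u\<close> and \<open>v\<close> axes.
  Their boxes of radius \<open>R - 1\<close> miss the corners of the large box, which are not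
  lattice points either.\<close>

lemma diagonal_box_eq_quadricentred:
  assumes "R \<ge> 1"
  shows "diagonal_box (2 * R) (i + j - R + 1) (i - j - R) =
     points_within (R - 1) {(i, j), (i + 1, j), (i, j + 1), (i + 1, j + 1)}"
  using assms unfolding diagonal_box_def points_within_def manhattan_le_iff
  by auto presburger+

text \<open>The second centre is the first shifted by \<open>(1, 1)\<close> in \<open>u\<close>,
  \<open>v\<close>. The two boxes of side \<open>2 * R\<close> miss only two opposite corners of the
  large box, where \<open>u\<close> and \<open>v\<close> have different parity.\<close>

lemma diagonal_box_eq_bicentred_horizontal:
  assumes "R \<ge> 0"
  shows "diagonal_box (2 * R + 1) (i + j - R) (i - j - R) =
     points_within R {(i, j), (i + 1, j)}"
  using assms unfolding diagonal_box_def points_within_def manhattan_le_iff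
  by auto presburger+

text \<open>Here the shift is \<open>(1, -1)\<close>, so the missed corners are the lower and the
  upper one.\<close>

lemma diagonal_box_eq_bicentred_vertical:
  assumes "R \<ge> 0"
  shows "diagonal_box (2 * R + 1) (i + j - R) (i - j - 1 - R) =
     points_within R {(i, j), (i, j + 1)}"
  using assms unfolding diagonal_box_def points_within_def manhattan_le_iff
  by auto presburger+

lemma even_add_rotated_coordinates:
  fixes u v :: int
  assumes "even (u + v)"
  obtains i j where "u = i + j" "v = i - j"
proof -
  obtain i where "u + v = 2 * i" using assms by blast
  then show thesis by (intro that[of i "u - i"]) auto
qed

lemma diagonal_box_even:
  assumes "R \<ge> 1"
  shows "lee_sphere R (diagonal_box (2 * R) a b) \<or>
     quadricentred_lee_sphere R (diagonal_box (2 * R) a b)"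
proof (cases "even (a + b)")
  case True
  \<comment> \<open>The middle \<open>(a + R, b + R)\<close> of the box is a lattice point, the
    centre of the Lee sphere.\<close>
  then have "even ((a + R) + (b + R))" by simp
  then obtain i j where "a + R = i + j" "b + R = i - j"
    by (rule even_add_rotated_coordinates)
  then have "a = i + j - R" "b = i - j - R" by auto
  then show ?thesis
    using diagonal_box_eq_lee_sphere by (auto simp: lee_sphere_def)
next
  case False
  \<comment> \<open>The middle is no lattice point; decreasing its \<open>u\<close> by 1 gives the
    lower left of the four centres.\<close>
  then have "even ((a + R - 1) + (b + R))" by simp
  then obtain i j where "a + R - 1 = i + j" "b + R = i - j"
    by (rule even_add_rotated_coordinates)
  then have "a = i + j - R + 1" "b = i - j - R" by auto
  then show ?thesis
    using diagonal_box_eq_quadricentred[OF assms] by (auto simp: quadricentred_lee_sphere_def)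
qed

lemma diagonal_box_odd:
  assumes "R \<ge> 0"
  shows "bicentred_lee_sphere R (diagonal_box (2 * R + 1) a b)"
proof (cases "even (a + b)")
  case True
  then have "even ((a + R) + (b + R))" by simp
  then obtain i j where "a + R = i + j" "b + R = i - j"
    by (rule even_add_rotated_coordinates)
  then have "a = i + j - R" "b = i - j - R" by auto
  then show ?thesis
    using diagonal_box_eq_bicentred_horizontal[OF assms] by (auto simp: bicentred_lee_sphere_def)
next
  case False
  \<comment> \<open>The lower bound on \<open>v\<close> comes from the centre
    \<open>(i, j + 1)\<close>, so \<open>(i, j)\<close> has \<open>v\<close> larger by 1.\<close>
  then have "even ((a + R) + (b + R + 1))" by simp
  then obtain i j where "a + R = i + j" "b + R + 1 = i - j"
    by (rule even_add_rotated_coordinates)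
  then have "a = i + j - R" "b = i - j - 1 - R" by auto
  then show ?thesis
    using diagonal_box_eq_bicentred_vertical[OF assms] by (auto simp: bicentred_lee_sphere_def)
qed

theorem theorem1:
  fixes r :: int
  assumes "r > 0"
  shows "(even r \<longrightarrow> (\<forall>S. maximal_anticode r S \<longrightarrow>
            lee_sphere (r div 2) S \<or> quadricentred_lee_sphere (r div 2) S)) \<and>
         (odd r \<longrightarrow> (\<forall>S. maximal_anticode r S \<longrightarrow>
            bicentred_lee_sphere ((r - 1) div 2) S))"
proof (intro conjI impI allI)
  fix S assume "even r" and S: "maximal_anticode r S"
  then obtain R where R: "r = 2 * R" by blast
  obtain a b where "S = diagonal_box r a b"
    using S assms by (meson maximal_anticode_diagonal_box order_less_imp_le)
  \<comment> \<open>From \<open>r = 2 * R > 0\<close> follows \<open>R \<ge> 1\<close>; in the odd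
    case \<open>r > 0\<close> only yields \<open>R \<ge> 0\<close>.\<close>
  then show "lee_sphere (r div 2) S \<or> quadricentred_lee_sphere (r div 2) S"
    using diagonal_box_even[of R a b] assms R by simp
next
  fix S assume "odd r" and S: "maximal_anticode r S"
  then obtain R where R: "r = 2 * R + 1" by (blast elim: oddE)
  obtain a b where "S = diagonal_box r a b"
    using S assms by (meson maximal_anticode_diagonal_box order_less_imp_le)
  then show "bicentred_lee_sphere ((r - 1) div 2) S"
    using diagonal_box_odd[of R a b] assms R by simp
qed

end
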